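(* Let $f$ be a positive increasing function on $(0,1)$ which is in the general case and such that the integral $\int_0^1 f(t)\,dt$ exists. Then the function $U(x)=\int_0^1 f(t)\cos xt\,dt$, $x>0$, has exactly one zero, which is simple, in each of the intervals $$\big(\pi/2,\,\pi\big),\quad\big((k+1/2)\pi,\,(k+3/2)\pi\big),\qquad k=1,2,\dots,$$ and no other positive zeros.
   Context: A function $f$ on $(0,1)$ is said to be in the exceptional case if there exist finitely many rational points $0=r_0<r_1<\cdots<r_N=1$ such that $f$ is constant on each open interval $(r_{k-1},r_k)$, $k=1,\dots,N$. Otherwise $f$ is said to be in the general case. "Increasing" is meant in the wide (non-strict) sense. *)

theory Defs
  imports "HOL-Analysis.Analysis"
begin

text \<open>The subdivision points \<open>r k\<close> are indexed by \<open>k \<le> N\<close>; the endpoint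
  conditions force \<open>N \<ge> 1\<close>. The values of \<open>f\<close> at the points \<open>r k\<close> and outside
  \<open>(0,1)\<close> do not matter.\<close>

definition exceptional_case :: "(real \<Rightarrow> real) \<Rightarrow> bool" where
  "exceptional_case f \<longleftrightarrow>
     (\<exists>(N::nat) (r::nat \<Rightarrow> real).
        r 0 = 0 \<and> r N = 1 \<and> (\<forall>k\<le>N. r k \<in> \<rat>) \<and>
        (\<forall>k\<in>{1..N}. r (k - 1) < r k \<and> f constant_on {r (k - 1)<..<r k}))"

definition general_case :: "(real \<Rightarrow> real) \<Rightarrow> bool" where
  "general_case f \<longleftrightarrow> \<not> exceptional_case f"

text \<open>A Henstock--Kurzweil integral over \<open>(0,1)\<close>: \<open>f\<close> may be unbounded near \<open>1\<close>,
  so a proper Riemann integral need not exist.\<close>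

definition cosine_transform :: "(real \<Rightarrow> real) \<Rightarrow> real \<Rightarrow> real" where
  "cosine_transform f x = integral {0<..<1} (\<lambda>t. f t * cos (x * t))"

definition simple_zero :: "(real \<Rightarrow> real) \<Rightarrow> real \<Rightarrow> bool" where
  "simple_zero g z \<longleftrightarrow> g z = 0 \<and> (\<exists>D. (g has_real_derivative D) (at z) \<and> D \<noteq> 0)"

definition exactly_one_zero_simple :: "(real \<Rightarrow> real) \<Rightarrow> real set \<Rightarrow> bool" where
  "exactly_one_zero_simple g I \<longleftrightarrow>
     (\<exists>!z. z \<in> I \<and> g z = 0) \<and> (\<forall>z\<in>I. g z = 0 \<longrightarrow> simple_zero g z)"

end

theory Submission
  imports Defs "HOL-Computational_Algebra.Fundamental_Theorem_Algebra"
begin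

text \<open>
  Write \<open>F(x) = \<integral> f(t) e\<^sup>i\<^sup>x\<^sup>t dt = U(x) + i V(x)\<close>. Cutting \<open>(0,1)\<close> into \<open>n\<close> equal pieces
  approximates \<open>F\<close> by a polynomial in \<open>w = e\<^sup>i\<^sup>x\<^sup>/\<^sup>n\<close> with increasing coefficients. By
  Enestrom and Kakeya its zeros lie in the closed unit disc, so the real part of its logarithmic
  derivative \<open>w P'(w) / P(w)\<close> is at least half its degree; in the limit this gives
  \<open>2 V \<integral> t f(t) sin xt dt \<ge> V\<^sup>2\<close> where \<open>U = 0\<close>. There \<open>U'\<close> and \<open>V\<close> thus have opposite signs.
  On the other hand \<open>U sin x - V cos x\<close> is the sine transform of the decreasing function
  \<open>f(1 - t)\<close>, which is positive in the general case. Hence at every positive zero of \<open>U\<close> the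
  derivative \<open>U'\<close> has the sign of \<open>cos x\<close>: a zero is simple, and two zeros cannot lie between
  consecutive zeros of the cosine. Existence follows from the same positivity at the zeros of
  the cosine, together with \<open>U(\<pi>) < 0\<close>.
\<close>

section \<open>Zeros and logarithmic derivatives of polynomials with increasing coefficients\<close>

text \<open>Away from zeros, the logarithmic derivative times \<open>w\<close> is the sum of
  \<open>w / (w - a)\<close> over the zeros \<open>a\<close>, and each summand has real part at
  least 1/2. Multiplying by \<open>(norm (poly p w))\<^sup>2\<close> covers zeros on the circle too.
  The induction splits off one zero at a time.\<close>

lemma log_derivative_ge_half_degree:
  fixes p :: "complex poly" and w :: complex
  assumes "\<And>z. poly p z = 0 \<Longrightarrow> norm z \<le> 1" and w: "norm w = 1"
  shows "real (degree p) * (norm (poly p w))\<^sup>2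
    \<le> 2 * Re (w * poly (pderiv p) w * cnj (poly p w))"
  using assms(1)
proof (induction "degree p" arbitrary: p)
  case 0
  then have "pderiv p = 0" by (simp add: pderiv_eq_0_iff)
  with 0 show ?case by simp
next
  case (Suc n)
  then have "\<not> constant (poly p)" by (simp add: constant_degree)
  then obtain a where a: "poly p a = 0" using fundamental_theorem_of_algebra by blast
  then obtain q where q: "p = [:- a, 1:] * q" by (auto simp: poly_eq_0_iff_dvd elim: dvdE)
  have "q \<noteq> 0" using Suc.hyps(2) q by auto
  then have dp: "degree p = Suc (degree q)" by (simp add: q degree_mult_eq del: mult_pCons_left)
  have IH: "real (degree q) * (norm (poly q w))\<^sup>2
    \<le> 2 * Re (w * poly (pderiv q) w * cnj (poly q w))"
    by (rule Suc.hyps(1)) (use Suc.prems Suc.hyps(2) dp q in auto)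
  have na: "norm a \<le> 1" using Suc.prems a by blast
  define Q where "Q = poly q w"
  define D where "D = poly (pderiv q) w"
  have pw: "poly p w = (w - a) * Q" by (simp add: q Q_def algebra_simps)
  have dpw: "poly (pderiv p) w = Q + (w - a) * D"
    unfolding q pderiv_mult poly_add poly_mult Q_def D_def by (simp add: pderiv_pCons algebra_simps)
  have w2: "(norm w)\<^sup>2 = 1" using w by simp
  have a2: "(norm a)\<^sup>2 \<le> 1" using na by (simp add: abs_square_le_1)
  \<comment> \<open>The right side minus the left side is
    \<open>(norm w)\<^sup>2 - (norm a)\<^sup>2\<close>.\<close>
  have *: "(norm (w - a))\<^sup>2 \<le> 2 * Re (w * cnj (w - a))"
    using w2 a2 unfolding cmod_power2 by (simp add: power2_eq_square algebra_simps)
  have "w * poly (pderiv p) w * cnj (poly p w) =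
      w * cnj (w - a) * (Q * cnj Q) + ((w - a) * cnj (w - a)) * (w * D * cnj Q)"
    unfolding pw dpw by (simp add: algebra_simps)
  also have "\<dots> = w * cnj (w - a) * of_real ((norm Q)\<^sup>2) + of_real ((norm (w - a))\<^sup>2) * (w * D * cnj Q)"
    by (simp only: complex_norm_square)
  finally have eq: "w * poly (pderiv p) w * cnj (poly p w) = \<dots>" .
  have lin: "Re (x * of_real r + of_real s * y) = Re x * r + s * Re y" for x y r s
    by simp
  have "2 * Re (w * poly (pderiv p) w * cnj (poly p w)) =
      2 * Re (w * cnj (w - a)) * (norm Q)\<^sup>2 + (norm (w - a))\<^sup>2 * (2 * Re (w * D * cnj Q))"
    unfolding eq lin by (simp only: algebra_simps)
  moreover have "(norm (w - a))\<^sup>2 * (norm Q)\<^sup>2 \<le> 2 * Re (w * cnj (w - a)) * (norm Q)\<^sup>2"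
    by (rule mult_right_mono[OF *]) simp
  moreover have "(norm (w - a))\<^sup>2 * (real (degree q) * (norm Q)\<^sup>2)
      \<le> (norm (w - a))\<^sup>2 * (2 * Re (w * D * cnj Q))"
    using IH by (intro mult_left_mono) (simp_all add: Q_def D_def)
  moreover have "real (degree p) * (norm (poly p w))\<^sup>2 =
      (norm (w - a))\<^sup>2 * (norm Q)\<^sup>2 + (norm (w - a))\<^sup>2 * (real (degree q) * (norm Q)\<^sup>2)"
    unfolding pw dp norm_mult power_mult_distrib by (simp add: distrib_right distrib_left)
  ultimately show ?case by linarith
qed

text \<open>Abel summation: multiplication by \<open>z - 1\<close> turns coefficients into
  increments, which are nonnegative for an increasing sequence.\<close>

lemma enestrom_kakeya_summation:
  fixes a :: "nat \<Rightarrow> real" and z :: complex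
  shows "(z - 1) * (\<Sum>j\<le>n. of_real (a j) * z ^ j) =
    of_real (a n) * z ^ Suc n - (of_real (a 0) + (\<Sum>j<n. of_real (a (Suc j) - a j) * z ^ Suc j))"
  by (induction n) (simp_all add: algebra_simps)

text \<open>At a zero outside the disc the leading term of the summation identity equals the sum of
  the others. Their increments telescope, so that sum has norm at most
  \<open>a n * norm z ^ n\<close>, too small for the leading term.\<close>

lemma enestrom_kakeya:
  fixes a :: "nat \<Rightarrow> real" and z :: complex
  assumes a0: "0 \<le> a 0" and inc: "\<And>j. j < n \<Longrightarrow> a j \<le> a (Suc j)" and an: "0 < a n"
    and zero: "(\<Sum>j\<le>n. of_real (a j) * z ^ j) = 0"
  shows "norm z \<le> 1"
proof (rule ccontr)
  assume "\<not> norm z \<le> 1"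
  then have z: "1 < norm z" by simp
  have "of_real (a n) * z ^ Suc n =
      of_real (a 0) + (\<Sum>j<n. of_real (a (Suc j) - a j) * z ^ Suc j)"
    using enestrom_kakeya_summation[of z a n] zero by simp
  then have "a n * norm z ^ Suc n =
      norm (of_real (a 0) + (\<Sum>j<n. of_real (a (Suc j) - a j) * z ^ Suc j))"
    using an by (metis abs_of_pos norm_mult norm_of_real norm_power)
  also have "\<dots> \<le> a 0 + (\<Sum>j<n. norm (of_real (a (Suc j) - a j) * z ^ Suc j))"
    using a0 by (intro norm_triangle_le add_mono sum_norm_le) auto
  also have "\<dots> \<le> a 0 * norm z ^ n + (\<Sum>j<n. (a (Suc j) - a j) * norm z ^ n)"
  proof (intro add_mono sum_mono)
    show "a 0 \<le> a 0 * norm z ^ n"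
      using a0 z by (simp add: mult_le_cancel_left1)
    fix j assume j: "j \<in> {..<n}"
    have "norm z ^ Suc j \<le> norm z ^ n" using j z by (intro power_increasing) auto
    moreover have "0 \<le> a (Suc j) - a j" using inc j by simp
    ultimately show "norm (of_real (a (Suc j) - a j) * z ^ Suc j) \<le> (a (Suc j) - a j) * norm z ^ n"
      unfolding norm_mult norm_power norm_of_real by (simp add: mult_left_mono del: power_Suc)
  qed
  also have "\<dots> = (a 0 + (\<Sum>j<n. a (Suc j) - a j)) * norm z ^ n"
    by (simp add: sum_distrib_right distrib_right)
  also have "(\<Sum>j<n. a (Suc j) - a j) = a n - a 0" by (rule sum_lessThan_telescope)
  finally have "a n * norm z ^ Suc n \<le> a n * norm z ^ n" by simp
  then have "norm z * norm z ^ n \<le> norm z ^ n" using an by simp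
  moreover have "0 < norm z ^ n" using z by (intro zero_less_power) linarith
  ultimately show False using z by (simp add: mult_le_cancel_right2)
qed

text \<open>Combines the two bounds; \<open>0 < a n\<close> makes the degree exactly
  \<open>n\<close>, and the sum with coefficients \<open>real j * a j\<close> is \<open>w\<close>
  times the derivative at \<open>w\<close>.\<close>

lemma enestrom_kakeya_log_derivative:
  fixes a :: "nat \<Rightarrow> real" and w :: complex
  assumes a0: "0 \<le> a 0" and inc: "\<And>j. j < n \<Longrightarrow> a j \<le> a (Suc j)" and an: "0 < a n"
    and w: "norm w = 1"
  shows "real n * (norm (\<Sum>j\<le>n. of_real (a j) * w ^ j))\<^sup>2
    \<le> 2 * Re ((\<Sum>j\<le>n. of_real (real j * a j) * w ^ j) * cnj (\<Sum>j\<le>n. of_real (a j) * w ^ j))"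
proof -
  define p where "p = (\<Sum>j\<le>n. monom (of_real (a j) :: complex) j)"
  have poly_p: "poly p z = (\<Sum>j\<le>n. of_real (a j) * z ^ j)" for z
    by (simp add: p_def poly_sum poly_monom)
  have cf: "coeff p i = (if i \<le> n then of_real (a i) else 0)" for i
    unfolding p_def by (simp add: coeff_sum coeff_monom)
  have deg: "degree p = n"
    by (rule antisym) (auto intro!: degree_le le_degree simp: cf, use an in simp)
  have dp: "w * poly (pderiv p) w = (\<Sum>j\<le>n. of_real (real j * a j) * w ^ j)"
  proof -
    have "w * poly (pderiv p) w = (\<Sum>j\<le>n. w * poly (pderiv (monom (of_real (a j)) j)) w)"
      by (simp add: p_def higher_pderiv_sum[of 1, simplified] poly_sum sum_distrib_left)
    also have "\<dots> = (\<Sum>j\<le>n. of_real (real j * a j) * w ^ j)"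
    proof (rule sum.cong[OF refl])
      fix j
      show "w * poly (pderiv (monom (of_real (a j)) j)) w = of_real (real j * a j) * w ^ j"
        by (cases j) (simp_all add: pderiv_monom poly_monom algebra_simps)
    qed
    finally show ?thesis .
  qed
  have "norm z \<le> 1" if "poly p z = 0" for z
    using enestrom_kakeya[of a n z] that a0 inc an by (simp add: poly_p)
  from log_derivative_ge_half_degree[of p, OF this w] show ?thesis
    unfolding deg poly_p dp .
qed

section \<open>Lipschitz and Taylor bounds for \<open>cis\<close> and \<open>cos\<close>\<close>

lemma norm_cis_diff_le: "norm (cis a - cis b) \<le> \<bar>a - b\<bar>"
proof -
  have d: "(cis has_derivative (\<lambda>h. h *\<^sub>R (\<i> * cis x))) (at x within UNIV)" for x
    by (rule has_derivative_cis[OF has_derivative_ident])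
  have "norm (cis a - cis b) \<le> 1 * norm (a - b)"
    by (rule differentiable_bound[OF convex_UNIV d])
       (auto intro!: onorm_bound simp: norm_mult)
  then show ?thesis by simp
qed

text \<open>Mean value inequality for \<open>cos (a + s) + s * sin a\<close>, whose derivative
  \<open>sin a - sin (a + s)\<close> is at most \<open>\<bar>b\<bar>\<close> in absolute value
  between 0 and \<open>b\<close>. The remainder bound serves to differentiate under the
  integral.\<close>

lemma abs_cos_linear_approx_le:
  fixes a b :: real
  shows "\<bar>cos (a + b) - cos a + b * sin a\<bar> \<le> b\<^sup>2"
proof -
  have sin_lip: "\<bar>sin y - sin x\<bar> \<le> \<bar>y - x\<bar>" for x y :: real
  proof -
    have "\<bar>sin y - sin x\<bar> = \<bar>Im (cis y - cis x)\<bar>" by simp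
    also have "\<dots> \<le> norm (cis y - cis x)" by (rule abs_Im_le_cmod)
    also have "\<dots> \<le> \<bar>y - x\<bar>" by (rule norm_cis_diff_le)
    finally show ?thesis .
  qed
  let ?h = "\<lambda>s. cos (a + s) + s * sin a"
  have "norm (?h b - ?h 0) \<le> \<bar>b\<bar> * norm (b - 0)"
  proof (rule differentiable_bound[of "closed_segment 0 b"])
    fix s assume s: "s \<in> closed_segment 0 b"
    show "(?h has_derivative (\<lambda>t. t * (sin a - sin (a + s)))) (at s within closed_segment 0 b)"
      by (auto intro!: derivative_eq_intros simp: algebra_simps)
    have "\<bar>s\<bar> \<le> \<bar>b\<bar>" using s by (auto simp: closed_segment_eq_real_ivl split: if_splits)
    with sin_lip[of a "a + s"] have "\<bar>sin a - sin (a + s)\<bar> \<le> \<bar>b\<bar>" by simp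
    then show "onorm (\<lambda>t. t * (sin a - sin (a + s))) \<le> \<bar>b\<bar>"
      by (intro onorm_bound) (simp_all add: abs_mult, metis abs_ge_zero mult.commute mult_right_mono)
  qed auto
  then show ?thesis by (simp add: power2_eq_square abs_mult)
qed

section \<open>Integration against an increasing weight\<close>

locale increasing_weight =
  fixes f :: "real \<Rightarrow> real"
  assumes pos: "\<And>t. 0 < t \<Longrightarrow> t < 1 \<Longrightarrow> 0 < f t"
    and mono: "\<And>s t. 0 < s \<Longrightarrow> s \<le> t \<Longrightarrow> t < 1 \<Longrightarrow> f s \<le> f t"
    and integrable: "f integrable_on {0<..<1}"
begin

lemma integrable_sub:
  assumes "0 \<le> a" "b \<le> 1"
  shows "f integrable_on {a..b}"
  using integrable_on_subinterval[of f "{0..1}" a b] integrable assms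
  by (auto simp: integrable_on_open_interval_real)

text \<open>A nonnegative integrable function is absolutely integrable, so a bounded measurable
  factor preserves integrability even if \<open>f\<close> is unbounded near 1.\<close>

lemma integrable_scaleR:
  fixes g :: "real \<Rightarrow> 'a::euclidean_space"
  assumes g: "continuous_on {0..1} g" and ab: "0 \<le> a" "b \<le> 1"
  shows "(\<lambda>t. f t *\<^sub>R g t) integrable_on {a..b}"
proof -
  have "f absolutely_integrable_on {0<..<1}"
    using integrable pos by (intro nonnegative_absolutely_integrable_1) (auto intro: less_imp_le)
  moreover have "g \<in> borel_measurable (lebesgue_on {0<..<1})"
    by (intro continuous_imp_measurable_on_sets_lebesgue continuous_on_subset[OF g]) auto
  moreover have "bounded (g ` {0<..<1})"
    by (rule bounded_subset[OF compact_imp_bounded[OF compact_continuous_image[OF g]]]) auto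
  moreover have "bilinear (\<lambda>(x::'a) (r::real). r *\<^sub>R x)"
    unfolding bilinear_def by (auto intro!: linearI simp: algebra_simps)
  ultimately have "(\<lambda>t. f t *\<^sub>R g t) absolutely_integrable_on {0<..<1}"
    using absolutely_integrable_bounded_measurable_product[of "\<lambda>x r. r *\<^sub>R x" g "{0<..<1}" f] by auto
  then have "(\<lambda>t. f t *\<^sub>R g t) integrable_on {0..1}"
    using integrable_on_open_interval_real set_lebesgue_integral_eq_integral(1) by blast
  then show ?thesis
    using integrable_on_subinterval[of "\<lambda>t. f t *\<^sub>R g t" "{0..1}" a b] ab by auto
qed

lemma integrable_mult:
  fixes g :: "real \<Rightarrow> real"
  assumes "continuous_on {0..1} g" "0 \<le> a" "b \<le> 1"
  shows "(\<lambda>t. f t * g t) integrable_on {a..b}"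
  using integrable_scaleR[OF assms] by simp

text \<open>The comparison is made on the open interval, because the sign of \<open>f\<close> is
  known only inside \<open>(0,1)\<close>.\<close>

lemma integral_norm_scaleR_le:
  fixes h :: "real \<Rightarrow> 'a::euclidean_space"
  assumes ab: "0 \<le> a" "b \<le> 1"
    and int: "(\<lambda>t. f t *\<^sub>R h t) integrable_on {a..b}"
    and le: "\<And>t. a < t \<Longrightarrow> t < b \<Longrightarrow> norm (h t) \<le> c"
  shows "norm (integral {a..b} (\<lambda>t. f t *\<^sub>R h t)) \<le> c * integral {a..b} f"
proof -
  have "norm (integral {a<..<b} (\<lambda>t. f t *\<^sub>R h t)) \<le> integral {a<..<b} (\<lambda>t. c * f t)"
  proof (rule integral_norm_bound_integral)
    show "(\<lambda>t. f t *\<^sub>R h t) integrable_on {a<..<b}"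
      using int by (simp add: integrable_on_open_interval_real)
    show "(\<lambda>t. c * f t) integrable_on {a<..<b}"
      using integrable_sub[OF ab] by (auto simp: integrable_on_open_interval_real intro: integrable_on_mult_right)
    fix t assume "t \<in> {a<..<b}"
    then show "norm (f t *\<^sub>R h t) \<le> c * f t"
      using le[of t] pos[of t] ab by (simp add: mult.commute mult_right_mono)
  qed
  then show ?thesis by (simp add: integral_open_interval_real)
qed

lemma integral_nonneg_sub:
  assumes "0 \<le> a" "b \<le> 1"
  shows "0 \<le> integral {a..b} f"
  unfolding integral_open_interval_real
  using assms pos integrable_sub[OF assms]
  by (intro integral_nonneg) (auto simp: integrable_on_open_interval_real intro!: less_imp_le)

text \<open>The value of \<open>f\<close> at 0 and 1 is arbitrary; \<open>b < 1\<close> here and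
  \<open>0 < a\<close> in the lower bound below keep the comparison value away from that
  end.\<close>

lemma integral_le_length:
  assumes "0 \<le> a" "a \<le> b" "b < 1"
  shows "integral {a..b} f \<le> f b * (b - a)"
proof -
  have "integral {a<..<b} f \<le> integral {a<..<b} (\<lambda>_. f b)"
    using assms mono integrable_sub[of a b]
    by (intro integral_le) (auto simp: integrable_on_open_interval_real)
  then show ?thesis using assms
    by (simp add: integral_open_interval_real[symmetric] mult.commute)
qed

lemma integral_ge_length:
  assumes "0 < a" "a \<le> b" "b \<le> 1"
  shows "f a * (b - a) \<le> integral {a..b} f"
proof -
  have "integral {a<..<b} (\<lambda>_. f a) \<le> integral {a<..<b} f"
    using assms mono integrable_sub[of a b]
    by (intro integral_le) (auto simp: integrable_on_open_interval_real)
  then show ?thesis using assms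
    by (simp add: integral_open_interval_real[symmetric] mult.commute)
qed

text \<open>The weights are exact integrals of \<open>f\<close> over the cells, so only the
  oscillation of \<open>g\<close> causes an error: at most \<open>L / real n\<close> times the mass
  of each cell.\<close>

lemma riemann_sum_error:
  fixes g :: "real \<Rightarrow> 'a::euclidean_space"
  assumes n: "0 < n" and m: "m \<le> n"
    and lip: "\<And>s t. s \<in> {0..1} \<Longrightarrow> t \<in> {0..1} \<Longrightarrow> norm (g s - g t) \<le> L * \<bar>s - t\<bar>"
    and L: "0 \<le> L" and cont: "continuous_on {0..1} g"
  shows "norm (integral {0..real m / real n} (\<lambda>t. f t *\<^sub>R g t)
      - (\<Sum>j<m. integral {real j / real n..real (Suc j) / real n} f *\<^sub>R g (real j / real n)))
    \<le> L / real n * integral {0..real m / real n} f"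
  using m
proof (induction m)
  case 0
  then show ?case by simp
next
  case (Suc m)
  let ?a = "real m / real n" and ?b = "real (Suc m) / real n"
  have ab: "0 \<le> ?a" "?a \<le> ?b" "?b \<le> 1" using n Suc.prems by (auto simp: field_simps)
  have c1: "integral {0..?b} (\<lambda>t. f t *\<^sub>R g t) =
      integral {0..?a} (\<lambda>t. f t *\<^sub>R g t) + integral {?a..?b} (\<lambda>t. f t *\<^sub>R g t)"
    using ab integrable_scaleR[OF cont, of 0 ?b]
    by (intro Henstock_Kurzweil_Integration.integral_combine[symmetric]) auto
  have c2: "integral {0..?b} f = integral {0..?a} f + integral {?a..?b} f"
    using ab integrable_sub[of 0 ?b]
    by (intro Henstock_Kurzweil_Integration.integral_combine[symmetric]) auto
  have "((\<lambda>t. f t *\<^sub>R g t - f t *\<^sub>R g ?a) has_integral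
      integral {?a..?b} (\<lambda>t. f t *\<^sub>R g t) - integral {?a..?b} f *\<^sub>R g ?a) {?a..?b}"
    using ab by (intro has_integral_diff has_integral_scaleR_left integrable_integral
        integrable_scaleR[OF cont] integrable_sub) auto
  then have "integral {?a..?b} (\<lambda>t. f t *\<^sub>R g t) - integral {?a..?b} f *\<^sub>R g ?a =
      integral {?a..?b} (\<lambda>t. f t *\<^sub>R (g t - g ?a))"
    by (simp add: scaleR_diff_right integral_unique del: of_nat_Suc)
  also have "norm \<dots> \<le> L / real n * integral {?a..?b} f"
  proof (rule integral_norm_scaleR_le)
    show "(\<lambda>t. f t *\<^sub>R (g t - g ?a)) integrable_on {?a..?b}"
      using ab by (intro integrable_scaleR continuous_intros cont) auto
    fix t assume t: "?a < t" "t < ?b"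
    then have "t \<in> {0..1}" "?a \<in> {0..1}" using ab unfolding atLeastAtMost_iff by linarith+
    then have "norm (g t - g ?a) \<le> L * \<bar>t - ?a\<bar>" by (rule lip)
    also have "\<bar>t - ?a\<bar> \<le> 1 / real n"
      using t by (simp add: add_divide_distrib)
    then have "L * \<bar>t - ?a\<bar> \<le> L * (1 / real n)"
      by (intro mult_left_mono L)
    finally show "norm (g t - g ?a) \<le> L / real n" by simp
  qed (use ab in auto)
  finally have e2: "norm (integral {?a..?b} (\<lambda>t. f t *\<^sub>R g t) - integral {?a..?b} f *\<^sub>R g ?a)
    \<le> L / real n * integral {?a..?b} f" .
  have e1: "norm (integral {0..?a} (\<lambda>t. f t *\<^sub>R g t)
      - (\<Sum>j<m. integral {real j / real n..real (Suc j) / real n} f *\<^sub>R g (real j / real n)))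
    \<le> L / real n * integral {0..?a} f" using Suc by simp
  show ?case
    unfolding c1 c2 sum.lessThan_Suc distrib_left add_diff_add by (rule norm_triangle_mono[OF e1 e2])
qed

text \<open>With \<open>Suc n\<close> cells the nodes are indexed by \<open>j \<le> n\<close>, which
  later yields a polynomial of degree \<open>n\<close>.\<close>

lemma riemann_sum_tendsto:
  fixes g :: "real \<Rightarrow> 'a::euclidean_space"
  assumes lip: "\<And>s t. s \<in> {0..1} \<Longrightarrow> t \<in> {0..1} \<Longrightarrow> norm (g s - g t) \<le> L * \<bar>s - t\<bar>"
    and L: "0 \<le> L"
  shows "(\<lambda>n. \<Sum>j\<le>n. integral {real j / real (Suc n)..real (Suc j) / real (Suc n)} f
      *\<^sub>R g (real j / real (Suc n))) \<longlonglongrightarrow> integral {0..1} (\<lambda>t. f t *\<^sub>R g t)"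
proof -
  have cont: "continuous_on {0..1} g"
    by (rule lipschitz_on_continuous_on[of L]) (auto intro!: lipschitz_onI lip L simp: dist_norm)
  let ?S = "\<lambda>n. \<Sum>j\<le>n. integral {real j / real (Suc n)..real (Suc j) / real (Suc n)} f
      *\<^sub>R g (real j / real (Suc n))"
  let ?I = "integral {0..1} (\<lambda>t. f t *\<^sub>R g t)"
  have bound: "norm (?S n - ?I) \<le> L * integral {0..1} f * inverse (real (Suc n))" for n
  proof -
    have "real (Suc n) / real (Suc n) = 1" by simp
    then have "norm (?I - ?S n) \<le> L / real (Suc n) * integral {0..1} f"
      using riemann_sum_error[of "Suc n" "Suc n" g L, OF _ _ lip L cont]
      unfolding lessThan_Suc_atMost by (metis le_refl zero_less_Suc)
    then show ?thesis by (simp only: norm_minus_commute divide_inverse mult_ac)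
  qed
  have "(\<lambda>n. L * integral {0..1} f * inverse (real (Suc n))) \<longlonglongrightarrow> L * integral {0..1} f * 0"
    by (intro tendsto_mult tendsto_const LIMSEQ_inverse_real_of_nat)
  then have "(\<lambda>n. L * integral {0..1} f * inverse (real (Suc n))) \<longlonglongrightarrow> 0" by simp
  then have "(\<lambda>n. ?S n - ?I) \<longlonglongrightarrow> 0"
    by (rule Lim_null_comparison[OF always_eventually, rotated]) (use bound in blast)
  then show ?thesis by (rule LIM_zero_cancel)
qed

section \<open>The energy inequality for the Fourier transform\<close>

text \<open>The Riemann sums of \<open>F\<close> are polynomials in
  \<open>cis (x / real (Suc n))\<close> whose coefficients increase with \<open>f\<close>; those of
  \<open>G\<close> are the corresponding \<open>w * p'(w)\<close> divided by \<open>Suc n\<close>.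
  The polynomial inequality passes to the limit.\<close>

lemma fourier_energy_inequality:
  fixes x :: real
  defines "F \<equiv> integral {0..1} (\<lambda>t. f t *\<^sub>R cis (x * t))"
    and "G \<equiv> integral {0..1} (\<lambda>t. f t *\<^sub>R (t *\<^sub>R cis (x * t)))"
  shows "(norm F)\<^sup>2 \<le> 2 * Re (G * cnj F)"
proof -
  define a where "a n j = integral {real j / real (Suc n)..real (Suc j) / real (Suc n)} f" for n j
  define P where "P n = (\<Sum>j\<le>n. a n j *\<^sub>R cis (x * (real j / real (Suc n))))" for n
  define Q where "Q n = (\<Sum>j\<le>n. a n j *\<^sub>R ((real j / real (Suc n)) *\<^sub>R cis (x * (real j / real (Suc n)))))" for n
  have lip: "norm (cis (x * s) - cis (x * t)) \<le> \<bar>x\<bar> * \<bar>s - t\<bar>" for s t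
    using norm_cis_diff_le[of "x * s" "x * t"] by (simp add: right_diff_distrib[symmetric] abs_mult)
  have P: "P \<longlonglongrightarrow> F"
    unfolding P_def F_def a_def by (rule riemann_sum_tendsto[OF lip]) simp
  have lip2: "norm (s *\<^sub>R cis (x * s) - t *\<^sub>R cis (x * t)) \<le> (\<bar>x\<bar> + 1) * \<bar>s - t\<bar>"
    if "s \<in> {0..1}" "t \<in> {0..1}" for s t
  proof -
    have "s *\<^sub>R cis (x * s) - t *\<^sub>R cis (x * t) =
        s *\<^sub>R (cis (x * s) - cis (x * t)) + (s - t) *\<^sub>R cis (x * t)"
      by (simp add: algebra_simps)
    also have "norm \<dots> \<le> \<bar>s\<bar> * norm (cis (x * s) - cis (x * t)) + \<bar>s - t\<bar>"
      by (rule norm_triangle_le) simp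
    also have "\<dots> \<le> 1 * (\<bar>x\<bar> * \<bar>s - t\<bar>) + \<bar>s - t\<bar>"
      using that by (intro add_right_mono mult_mono lip) auto
    finally show ?thesis by (simp add: distrib_right)
  qed
  have Q: "Q \<longlonglongrightarrow> G"
    unfolding Q_def G_def a_def by (rule riemann_sum_tendsto[OF lip2]) simp_all
  have ineq: "real n / real (Suc n) * (norm (P n))\<^sup>2 \<le> 2 * Re (Q n * cnj (P n))" for n
  \<comment> \<open>For \<open>n = 0\<close> the positivity argument for the top coefficient would
    evaluate \<open>f\<close> at 0; here both sides vanish instead.\<close>
  proof (cases "n = 0")
    case True
    then show ?thesis by (simp add: Q_def)
  next
    case False
    define w where "w = cis (x / real (Suc n))"
    have pw: "cis (x * (real j / real (Suc n))) = w ^ j" for j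
      unfolding w_def Complex.DeMoivre by (simp add: mult.commute)
    have Pw: "P n = (\<Sum>j\<le>n. of_real (a n j) * w ^ j)"
      unfolding P_def pw scaleR_conv_of_real ..
    have Qw: "(\<Sum>j\<le>n. of_real (real j * a n j) * w ^ j) = of_real (real (Suc n)) * Q n"
      unfolding Q_def pw scaleR_conv_of_real sum_distrib_left
      by (intro sum.cong refl) (simp add: field_simps del: of_nat_Suc)
    have Re_mult: "Re (of_real r * z) = r * Re z" for r z by simp
    have "real n * (norm (P n))\<^sup>2 \<le> 2 * Re (of_real (real (Suc n)) * Q n * cnj (P n))"
      unfolding Pw Qw[symmetric]
    proof (rule enestrom_kakeya_log_derivative)
      show "0 \<le> a n 0" unfolding a_def by (rule integral_nonneg_sub) auto
      show "norm w = 1" by (simp add: w_def)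
      \<comment> \<open>The last cell is bounded below through its left end, an interior point since
        \<open>n\<close> is nonzero.\<close>
      have "0 < f (real n / real (Suc n)) * (real (Suc n) / real (Suc n) - real n / real (Suc n))"
        using False pos[of "real n / real (Suc n)"] by (simp add: field_simps)
      also have "\<dots> \<le> a n n"
        unfolding a_def using False by (intro integral_ge_length) (auto simp: divide_simps)
      finally show "0 < a n n" .
      fix j assume j: "j < n"
      have step: "real (Suc k) / real (Suc n) - real k / real (Suc n) = 1 / real (Suc n)" for k
        by (simp add: diff_divide_distrib[symmetric])
      \<comment> \<open>Adjacent cells are compared through the value of \<open>f\<close> at their
        common end point.\<close>
      have "a n j \<le> f (real (Suc j) / real (Suc n)) * (real (Suc j) / real (Suc n) - real j / real (Suc n))"
        unfolding a_def using j by (intro integral_le_length) (auto simp: divide_simps)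
      also have "\<dots> = f (real (Suc j) / real (Suc n)) * (real (Suc (Suc j)) / real (Suc n) - real (Suc j) / real (Suc n))"
        unfolding step ..
      also have "\<dots> \<le> a n (Suc j)"
        unfolding a_def using j by (intro integral_ge_length) (auto simp: divide_simps)
      finally show "a n j \<le> a n (Suc j)" .
    qed
    also have "of_real (real (Suc n)) * Q n * cnj (P n) = of_real (real (Suc n)) * (Q n * cnj (P n))"
      by (rule mult.assoc)
    also have "Re \<dots> = real (Suc n) * Re (Q n * cnj (P n))"
      by (rule Re_mult)
    finally show ?thesis by (simp add: field_simps del: times_complex.sel of_nat_Suc)
  qed
  have "(\<lambda>n. real n / real (Suc n) * (norm (P n))\<^sup>2) \<longlonglongrightarrow> 1 * (norm F)\<^sup>2"
    by (intro tendsto_intros P LIMSEQ_n_over_Suc_n)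
  moreover have "(\<lambda>n. 2 * Re (Q n * cnj (P n))) \<longlonglongrightarrow> 2 * Re (G * cnj F)"
    by (intro tendsto_intros P Q)
  ultimately show ?thesis
    by (intro LIMSEQ_le[of _ _ _ "2 * Re (G * cnj F)"]) (use ineq in auto)
qed

section \<open>Positivity of integrals by second mean values\<close>

text \<open>In the following, \<open>T u\<close> is the tail integral of \<open>\<phi>\<close> over \<open>[u, 1]\<close>. Summation by parts
  makes the integral of \<open>f * \<phi>\<close> an average of the values of \<open>T\<close>, weighted by the increments of \<open>f\<close>.\<close>

lemma second_mean_value_tail:
  assumes T: "\<And>t. (T has_real_derivative - \<phi> t) (at t)" and \<phi>: "continuous_on UNIV \<phi>"
    and ab: "0 < a" "a \<le> b" "b < 1"
  obtains c where "a \<le> c" "c \<le> b"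
    "integral {a..b} (\<lambda>t. f t * \<phi> t) = f a * T a - f b * T b + (f b - f a) * T c"
proof -
  have int: "integral {u..v} \<phi> = T u - T v" if "u \<le> v" for u v
  proof -
    have "((\<lambda>t. - \<phi> t) has_integral T v - T u) {u..v}"
      using that T by (intro fundamental_theorem_of_calculus)
        (auto simp: has_real_derivative_iff_has_vector_derivative[symmetric] intro: has_field_derivative_at_within)
    from has_integral_neg[OF this] show ?thesis by (simp add: integral_unique)
  qed
  obtain c where c: "c \<in> {a..b}"
    "integral {a..b} (\<lambda>t. f t * \<phi> t) = f a * integral {a..c} \<phi> + f b * integral {c..b} \<phi>"
    using second_mean_value_theorem[of \<phi> a b f] ab mono
      integrable_continuous_real[OF continuous_on_subset[OF \<phi>]] by (metis subset_UNIV order_less_le_trans order_le_less_trans)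
  then show thesis
    using int[of a c] int[of c b] by (intro that[of c]) (auto simp: algebra_simps)
qed

text \<open>The mean value formula is applied on \<open>{v..b}\<close> with \<open>b < 1\<close>.
  The boundary term \<open>f b * T b\<close> and the rest of the integral are each at most
  \<open>integral {b..1} f\<close>, which tends to 0 as \<open>b\<close> tends to 1.\<close>

lemma integral_mult_tail_ge:
  assumes T: "\<And>t. (T has_real_derivative - \<phi> t) (at t)" and \<phi>: "continuous_on UNIV \<phi>"
    and T1: "T 1 = 0" and \<phi>1: "\<And>t. \<bar>\<phi> t\<bar> \<le> 1"
    and Tpos: "\<And>t. 0 \<le> t \<Longrightarrow> t \<le> 1 \<Longrightarrow> 0 \<le> T t"
    and v: "0 < v" "v < 1"
  shows "f v * T v \<le> integral {v..1} (\<lambda>t. f t * \<phi> t)"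
proof -
  have \<phi>': "continuous_on {0..1} \<phi>" using \<phi> continuous_on_subset by blast
  have le: "f v * T v - 2 * integral {b..1} f \<le> integral {v..1} (\<lambda>t. f t * \<phi> t)"
    if b: "v < b" "b < 1" for b
  proof -
    obtain c where c: "v \<le> c" "c \<le> b"
      "integral {v..b} (\<lambda>t. f t * \<phi> t) = f v * T v - f b * T b + (f b - f v) * T c"
      using second_mean_value_tail[OF T \<phi>, of v b] v b by auto
    have "0 \<le> (f b - f v) * T c"
      using c b v mono[of v b] Tpos[of c] by (intro mult_nonneg_nonneg) auto
    moreover have "T b \<le> 1 - b"
    proof -
      obtain z where "T 1 - T b = (1 - b) * - \<phi> z"
        using MVT2[of b 1 T "\<lambda>t. - \<phi> t"] T b by auto
      then have "T b = (1 - b) * \<phi> z" using T1 by simp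
      also have "\<dots> \<le> (1 - b) * 1" using b \<phi>1[of z] by (intro mult_left_mono) auto
      finally show ?thesis by simp
    qed
    then have "f b * T b \<le> f b * (1 - b)" using pos[of b] b v by (intro mult_left_mono) auto
    then have "f b * T b \<le> integral {b..1} f" using integral_ge_length[of b 1] b v by simp
    moreover have "\<bar>integral {b..1} (\<lambda>t. f t * \<phi> t)\<bar> \<le> integral {b..1} f"
      using integral_norm_scaleR_le[of b 1 \<phi> 1] integrable_mult[OF \<phi>', of b 1] b v \<phi>1 by simp
    moreover have "integral {v..1} (\<lambda>t. f t * \<phi> t) =
        integral {v..b} (\<lambda>t. f t * \<phi> t) + integral {b..1} (\<lambda>t. f t * \<phi> t)"
      using v b integrable_mult[OF \<phi>', of v 1]
      by (intro Henstock_Kurzweil_Integration.integral_combine[symmetric]) auto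
    ultimately show ?thesis using c(3) by linarith
  qed
  have "((\<lambda>b. integral {b..1} f) \<longlongrightarrow> integral {1..1} f) (at_left 1)"
    by (rule continuous_on_Icc_at_leftD[OF indefinite_integral_continuous_1'[OF integrable_sub[of 0 1]]]) auto
  then have "((\<lambda>b. f v * T v - 2 * integral {b..1} f) \<longlongrightarrow> f v * T v - 2 * 0) (at_left 1)"
    by (intro tendsto_intros) simp
  then show ?thesis
    using tendsto_upperbound[of "\<lambda>b. f v * T v - 2 * integral {b..1} f" "f v * T v" "at_left (1::real)"] v le
    by (auto simp: eventually_at_left_field)
qed

text \<open>The mean value formula requires a positive left end; continuity of the integral carries
  its lower bounds down to 0.\<close>

lemma integral_mult_head_ge:
  assumes \<phi>: "continuous_on UNIV \<phi>" and v: "0 < v" "v < 1"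
    and le: "\<And>a. 0 < a \<Longrightarrow> a < v \<Longrightarrow> K \<le> integral {a..v} (\<lambda>t. f t * \<phi> t)"
  shows "K \<le> integral {0..v} (\<lambda>t. f t * \<phi> t)"
proof -
  have "continuous_on {0..v} (\<lambda>a. integral {a..v} (\<lambda>t. f t * \<phi> t))"
    using v \<phi> by (intro indefinite_integral_continuous_1' integrable_mult) (auto intro: continuous_on_subset)
  then have "((\<lambda>a. integral {a..v} (\<lambda>t. f t * \<phi> t)) \<longlongrightarrow> integral {0..v} (\<lambda>t. f t * \<phi> t)) (at_right 0)"
    using v(1) by (rule continuous_on_Icc_at_rightD)
  then show ?thesis
    using v le by (intro tendsto_lowerbound[where F = "at_right (0::real)"]) (auto simp: eventually_at_right_field)
qed

text \<open>Near 0 the tail exceeds \<open>T 0 / 2\<close>, so the head integral is at least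
  \<open>f v * (T 0 / 2) - f v * T v\<close>; the last term cancels against the tail bound.\<close>

lemma integral_mult_pos_of_initial_tail:
  assumes T: "\<And>t. (T has_real_derivative - \<phi> t) (at t)" and \<phi>: "continuous_on UNIV \<phi>"
    and T1: "T 1 = 0" and \<phi>1: "\<And>t. \<bar>\<phi> t\<bar> \<le> 1"
    and Tpos: "\<And>t. 0 \<le> t \<Longrightarrow> t \<le> 1 \<Longrightarrow> 0 \<le> T t"
    and T0: "0 < T 0"
  shows "0 < integral {0..1} (\<lambda>t. f t * \<phi> t)"
proof -
  have "isCont T 0" using T DERIV_isCont by blast
  then have "eventually (\<lambda>t. T 0 / 2 < T t) (nhds 0)"
    using T0 by (intro order_tendstoD) (auto simp: isCont_def tendsto_nhds_iff)
  then obtain d where d: "0 < d" "\<And>t. \<bar>t\<bar> < d \<Longrightarrow> T 0 / 2 < T t"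
    by (auto simp: eventually_nhds_metric dist_real_def)
  define v where "v = min (d / 2) (1 / 2)"
  have v: "0 < v" "v < 1" "v < d" using d(1) by (auto simp: v_def min_def)
  have "f v * (T 0 / 2) - f v * T v \<le> integral {0..v} (\<lambda>t. f t * \<phi> t)"
  proof (rule integral_mult_head_ge[OF \<phi> v(1,2)])
    fix a assume a: "0 < a" "a < v"
    obtain c where c: "a \<le> c" "c \<le> v"
      "integral {a..v} (\<lambda>t. f t * \<phi> t) = f a * T a - f v * T v + (f v - f a) * T c"
      using second_mean_value_tail[OF T \<phi>, of a v] v a by auto
    have "f a * (T 0 / 2) \<le> f a * T a"
      using pos[of a] d(2)[of a] a v by (intro mult_left_mono) auto
    moreover have "(f v - f a) * (T 0 / 2) \<le> (f v - f a) * T c"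
      using mono[of a v] d(2)[of c] a v c by (intro mult_left_mono) auto
    moreover have "f v * (T 0 / 2) = f a * (T 0 / 2) + (f v - f a) * (T 0 / 2)"
      by (simp add: distrib_right[symmetric])
    ultimately show "f v * (T 0 / 2) - f v * T v \<le> integral {a..v} (\<lambda>t. f t * \<phi> t)"
      using c(3) by linarith
  qed
  moreover have "f v * T v \<le> integral {v..1} (\<lambda>t. f t * \<phi> t)"
    by (rule integral_mult_tail_ge[OF T \<phi> T1 \<phi>1 Tpos v(1,2)])
  moreover have "integral {0..1} (\<lambda>t. f t * \<phi> t) =
      integral {0..v} (\<lambda>t. f t * \<phi> t) + integral {v..1} (\<lambda>t. f t * \<phi> t)"
    using v \<phi> by (intro Henstock_Kurzweil_Integration.integral_combine[symmetric] integrable_mult)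
      (auto intro: continuous_on_subset)
  moreover have "0 < f v * (T 0 / 2)" using pos v T0 by simp
  ultimately show ?thesis by linarith
qed

text \<open>For the case that \<open>T 0\<close> may vanish: the boundary terms at \<open>u\<close>
  and \<open>v\<close> cancel across the three pieces, and the gain \<open>(f v - f u) * T c\<close>
  from the increase of \<open>f\<close> remains.\<close>

lemma integral_mult_pos_of_increase:
  assumes T: "\<And>t. (T has_real_derivative - \<phi> t) (at t)" and \<phi>: "continuous_on UNIV \<phi>"
    and T1: "T 1 = 0" and \<phi>1: "\<And>t. \<bar>\<phi> t\<bar> \<le> 1"
    and Tpos: "\<And>t. 0 \<le> t \<Longrightarrow> t \<le> 1 \<Longrightarrow> 0 \<le> T t"
    and uv: "0 < u" "u \<le> v" "v < 1" "f u < f v" and Tuv: "\<And>t. u \<le> t \<Longrightarrow> t \<le> v \<Longrightarrow> 0 < T t"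
  shows "0 < integral {0..1} (\<lambda>t. f t * \<phi> t)"
proof -
  have "- f u * T u \<le> integral {0..u} (\<lambda>t. f t * \<phi> t)"
  proof (rule integral_mult_head_ge[OF \<phi> uv(1)])
    show "u < 1" using uv by simp
    fix a assume a: "0 < a" "a < u"
    obtain c where c: "a \<le> c" "c \<le> u"
      "integral {a..u} (\<lambda>t. f t * \<phi> t) = f a * T a - f u * T u + (f u - f a) * T c"
      using second_mean_value_tail[OF T \<phi>, of a u] uv a by auto
    have "0 \<le> f a * T a" using pos[of a] Tpos[of a] a uv by (intro mult_nonneg_nonneg) auto
    moreover have "0 \<le> (f u - f a) * T c"
      using mono[of a u] Tpos[of c] a uv c by (intro mult_nonneg_nonneg) auto
    ultimately show "- f u * T u \<le> integral {a..u} (\<lambda>t. f t * \<phi> t)"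
      using c(3) by simp
  qed
  moreover obtain c where c: "u \<le> c" "c \<le> v"
      "integral {u..v} (\<lambda>t. f t * \<phi> t) = f u * T u - f v * T v + (f v - f u) * T c"
    using second_mean_value_tail[OF T \<phi>, of u v] uv by auto
  moreover have "0 < (f v - f u) * T c" using uv Tuv c by simp
  moreover have "f v * T v \<le> integral {v..1} (\<lambda>t. f t * \<phi> t)"
    by (rule integral_mult_tail_ge[OF T \<phi> T1 \<phi>1 Tpos]) (use uv in auto)
  moreover have "integral {0..v} (\<lambda>t. f t * \<phi> t) =
      integral {0..u} (\<lambda>t. f t * \<phi> t) + integral {u..v} (\<lambda>t. f t * \<phi> t)"
    using uv \<phi> by (intro Henstock_Kurzweil_Integration.integral_combine[symmetric] integrable_mult)
      (auto intro: continuous_on_subset)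
  moreover have "integral {0..1} (\<lambda>t. f t * \<phi> t) =
      integral {0..v} (\<lambda>t. f t * \<phi> t) + integral {v..1} (\<lambda>t. f t * \<phi> t)"
    using uv \<phi> by (intro Henstock_Kurzweil_Integration.integral_combine[symmetric] integrable_mult)
      (auto intro: continuous_on_subset)
  ultimately show ?thesis by linarith
qed

section \<open>The cosine transform and its derivative\<close>

lemma cosine_transform_eq: "cosine_transform f x = integral {0..1} (\<lambda>t. f t * cos (x * t))"
  by (simp add: cosine_transform_def integral_open_interval_real)

text \<open>The quadratic remainder of the cosine, integrated against \<open>f\<close>, leaves an
  error of at most \<open>\<bar>h\<bar> * integral {0..1} f\<close> in the difference
  quotient.\<close>

lemma cosine_transform_has_derivative:
  "(cosine_transform f has_real_derivative - integral {0..1} (\<lambda>t. f t * (t * sin (x * t)))) (at x)"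
proof -
  let ?D = "- integral {0..1} (\<lambda>t. f t * (t * sin (x * t)))"
  let ?U = "cosine_transform f"
  have bound: "\<bar>?U (x + h) - ?U x - h * ?D\<bar> \<le> h\<^sup>2 * integral {0..1} f" for h
  proof -
    have "((\<lambda>t. f t * cos ((x + h) * t) - f t * cos (x * t) + h * (f t * (t * sin (x * t)))) has_integral
        ?U (x + h) - ?U x + h * integral {0..1} (\<lambda>t. f t * (t * sin (x * t)))) {0..1}"
      unfolding cosine_transform_eq
      by (intro has_integral_add has_integral_diff has_integral_mult_right integrable_integral
          integrable_mult continuous_intros) auto
    then have eq: "((\<lambda>t. f t *\<^sub>R (cos (x * t + h * t) - cos (x * t) + h * t * sin (x * t))) has_integral
        ?U (x + h) - ?U x - h * ?D) {0..1}"
      by (simp add: algebra_simps)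
    have "norm (integral {0..1} (\<lambda>t. f t *\<^sub>R (cos (x * t + h * t) - cos (x * t) + h * t * sin (x * t))))
        \<le> h\<^sup>2 * integral {0..1} f"
    proof (rule integral_norm_scaleR_le)
      fix t :: real assume t: "0 < t" "t < 1"
      have "\<bar>cos (x * t + h * t) - cos (x * t) + h * t * sin (x * t)\<bar> \<le> (h * t)\<^sup>2"
        by (rule abs_cos_linear_approx_le)
      also have "\<dots> \<le> h\<^sup>2" using t by (simp add: power_mult_distrib mult_left_le power_le_one)
      finally show "norm (cos (x * t + h * t) - cos (x * t) + h * t * sin (x * t)) \<le> h\<^sup>2" by simp
    qed (use eq in auto)
    then show ?thesis using integral_unique[OF eq] by simp
  qed
  have "(\<lambda>h. (?U (x + h) - ?U x) / h - ?D) \<midarrow>0\<rightarrow> 0"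
  proof (rule Lim_null_comparison)
    show "((\<lambda>h. \<bar>h\<bar> * integral {0..1} f) \<longlongrightarrow> 0) (at 0)"
      by (intro tendsto_mult_left_zero tendsto_rabs_zero tendsto_ident_at)
    show "\<forall>\<^sub>F h in at 0. norm ((?U (x + h) - ?U x) / h - ?D) \<le> \<bar>h\<bar> * integral {0..1} f"
    proof (rule eventually_at_ball'[THEN eventually_mono])
      fix h :: real assume h: "h \<in> ball 0 1 \<and> h \<noteq> 0 \<and> h \<in> UNIV"
      then have "(?U (x + h) - ?U x) / h - ?D = (?U (x + h) - ?U x - h * ?D) / h"
        by (simp add: field_simps)
      also have "norm \<dots> \<le> h\<^sup>2 * integral {0..1} f / \<bar>h\<bar>"
        unfolding real_norm_def abs_divide by (rule divide_right_mono[OF bound]) simp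
      also have "\<dots> = \<bar>h\<bar> * integral {0..1} f"
        using h by (simp add: power2_eq_square field_simps abs_if)
      finally show "norm ((?U (x + h) - ?U x) / h - ?D) \<le> \<bar>h\<bar> * integral {0..1} f" .
    qed simp
  qed
  then show ?thesis unfolding DERIV_def by (rule LIM_zero_cancel)
qed

text \<open>At a zero of the transform \<open>F\<close> equals \<open>\<i> * V\<close>, so the
  energy inequality involves only \<open>V\<close> and the imaginary part of
  \<open>G\<close>.\<close>

lemma cosine_transform_zero_energy:
  assumes "cosine_transform f x = 0"
  defines "V \<equiv> integral {0..1} (\<lambda>t. f t * sin (x * t))"
  shows "V\<^sup>2 \<le> 2 * (integral {0..1} (\<lambda>t. f t * (t * sin (x * t))) * V)"
proof -
  define F where "F = integral {0..1} (\<lambda>t. f t *\<^sub>R cis (x * t))"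
  define G where "G = integral {0..1} (\<lambda>t. f t *\<^sub>R (t *\<^sub>R cis (x * t)))"
  have cis: "continuous_on {0..1} (\<lambda>t. cis (x * t))" by (intro continuous_intros)
  have intF: "(\<lambda>t. f t *\<^sub>R cis (x * t)) integrable_on {0..1}"
    by (rule integrable_scaleR[OF cis]) auto
  have intG: "(\<lambda>t. f t *\<^sub>R (t *\<^sub>R cis (x * t))) integrable_on {0..1}"
    by (rule integrable_scaleR) (auto intro!: continuous_intros cis)
  have "Re F = 0"
    using integral_linear[OF intF bounded_linear_Re] assms(1)
    by (simp add: F_def o_def cosine_transform_eq)
  moreover have "Im F = V"
    using integral_linear[OF intF bounded_linear_Im] by (simp add: F_def V_def o_def)
  moreover have "Im G = integral {0..1} (\<lambda>t. f t * (t * sin (x * t)))"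
    using integral_linear[OF intG bounded_linear_Im] by (simp add: G_def o_def del: scaleR_scaleR)
  moreover have "(norm F)\<^sup>2 \<le> 2 * Re (G * cnj F)"
    unfolding F_def G_def by (rule fourier_energy_inequality)
  ultimately show ?thesis by (simp add: cmod_power2)
qed

end

section \<open>Functions crossing zero upwards, and signs of sine and cosine\<close>

text \<open>After \<open>a\<close> the function is positive; the first point where it is again
  nonpositive would be a zero reached from above, contrary to its positive derivative there.\<close>

lemma real_zeros_unique_of_deriv_pos:
  fixes g :: "real \<Rightarrow> real"
  assumes "a < b" and zeros: "g a = 0" "g b = 0"
    and cont: "continuous_on {a..b} g"
    and deriv: "\<And>x. a \<le> x \<Longrightarrow> x \<le> b \<Longrightarrow> g x = 0 \<Longrightarrow> \<exists>D>0. (g has_real_derivative D) (at x)"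
  shows False
proof -
  obtain D where "D > 0" "(g has_real_derivative D) (at a)" using deriv[of a] \<open>a < b\<close> zeros(1) by force
  then obtain d where d: "d > 0" "\<And>h. 0 < h \<Longrightarrow> h < d \<Longrightarrow> g a < g (a + h)"
    using DERIV_pos_inc_right by blast
  define a' where "a' = a + min (d / 2) ((b - a) / 2)"
  have a': "a < a'" "a' < b" using d(1) \<open>a < b\<close> by (auto simp: a'_def min_def field_simps)
  have ga': "0 < g a'"
    using d(2)[of "a' - a"] d(1) \<open>a < b\<close> zeros a' by (auto simp: a'_def min_def split: if_splits)
  \<comment> \<open>The start \<open>a'\<close> excludes the zero \<open>a\<close> itself, so
    \<open>Inf S\<close> is the first return to nonpositive values.\<close>
  define S where "S = {t \<in> {a'..b}. g t \<le> 0}"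
  have cont': "continuous_on {a'..b} g" using cont a' by (auto intro: continuous_on_subset)
  have "closed S"
    using continuous_closed_preimage[OF cont' closed_atLeastAtMost closed_atMost[of 0]]
    by (simp add: S_def vimage_def Int_def)
  moreover have "bdd_below S" unfolding S_def by auto
  moreover have "S \<noteq> {}" using a' zeros by (auto simp: S_def)
  ultimately have c: "Inf S \<in> S" by (intro closed_contains_Inf)
  have less: "0 < g t" if "a' \<le> t" "t < Inf S" for t
    using cInf_lower[OF _ \<open>bdd_below S\<close>, of t] that c unfolding S_def by force
  have cS: "a' \<le> Inf S" "g (Inf S) \<le> 0" using c by (auto simp: S_def)
  then have "a' < Inf S" using ga' by (cases "a' = Inf S") auto
  have gc: "g (Inf S) = 0"
  proof (rule ccontr)
    assume "g (Inf S) \<noteq> 0"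
    then have "g (Inf S) < 0" using c by (auto simp: S_def)
    moreover have "continuous_on {a'..Inf S} g"
      using cont' c by (auto simp: S_def intro: continuous_on_subset)
    ultimately obtain t where "a' \<le> t" "t \<le> Inf S" "g t = 0"
      using IVT2'[of g "Inf S" 0 a'] ga' \<open>a' < Inf S\<close> by auto
    then show False using less[of t] \<open>g (Inf S) < 0\<close> by (cases "t = Inf S") auto
  qed
  have "a \<le> Inf S" "Inf S \<le> b" using c a' by (auto simp: S_def)
  then obtain D' where "D' > 0" "(g has_real_derivative D') (at (Inf S))"
    using deriv[of "Inf S"] gc by auto
  then obtain e where e: "e > 0" "\<And>h. 0 < h \<Longrightarrow> h < e \<Longrightarrow> g (Inf S - h) < g (Inf S)"
    using DERIV_pos_inc_left by blast
  \<comment> \<open>Small enough for the derivative to force a negative value at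
    \<open>Inf S - h\<close>, yet not reaching below \<open>a'\<close>, so that the value there is
    positive.\<close>
  define h where "h = min (e / 2) (Inf S - a')"
  have "0 < h" "h < e" "a' \<le> Inf S - h"
    using e(1) \<open>a' < Inf S\<close> by (auto simp: h_def min_def)
  then show False using e(2)[of h] less[of "Inf S - h"] gc by auto
qed

lemma cos_alternating_pos:
  assumes "(real k - 1 / 2) * pi < t" "t < (real k + 1 / 2) * pi"
  shows "0 < (- 1) ^ k * cos t"
proof -
  have "0 < cos (t - real k * pi)"
    by (rule cos_gt_zero_pi) (use assms in \<open>auto simp: algebra_simps\<close>)
  also have "cos (t - real k * pi) = (- 1) ^ k * cos t"
    by (simp add: cos_diff mult.commute)
  finally show ?thesis .
qed

lemma cos_half_odd_pi: "cos ((real k + 1 / 2) * pi) = 0"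
  by (simp add: distrib_right cos_add)

lemma sin_half_odd_pi: "sin ((real k + 1 / 2) * pi) = (- 1) ^ k"
  by (simp add: distrib_right sin_add)

section \<open>Signs and zeros of the cosine transform in the general case\<close>

context increasing_weight
begin

text \<open>The multiples of \<open>1 / m\<close> are rational, so constancy on all \<open>m\<close>
  open cells would be the exceptional case. Every use of the general case passes through this
  fact.\<close>

lemma general_case_increase:
  assumes gen: "general_case f" and m: "0 < m"
  obtains k u v where "k < m" "real k / real m < u" "u < v" "v < real (Suc k) / real m" "f u < f v"
proof -
  have "\<exists>k\<in>{1..m}. \<not> f constant_on {real (k - 1) / real m<..<real k / real m}"
  proof (rule ccontr)
    assume "\<not> ?thesis"
    then have "exceptional_case f"
      unfolding exceptional_case_def
      using m by (intro exI[of _ m] exI[of _ "\<lambda>k. real k / real m"])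
        (auto simp: divide_strict_right_mono)
    with gen show False by (simp add: general_case_def)
  qed
  then obtain k where k: "k \<in> {1..m}" "\<not> f constant_on {real (k - 1) / real m<..<real k / real m}"
    by blast
  then obtain s t where st: "s \<in> {real (k - 1) / real m<..<real k / real m}"
    "t \<in> {real (k - 1) / real m<..<real k / real m}" "f s \<noteq> f t"
    unfolding constant_on_def by metis
  have km: "real k / real m \<le> 1" "0 \<le> real (k - 1) / real m" using k m by auto
  define u v where "u = min s t" and "v = max s t"
  have uv: "real (k - 1) / real m < u" "u < v" "v < real k / real m"
    using st by (auto simp: u_def v_def min_def max_def less_le)
  have "f u \<le> f v" using uv km by (intro mono) linarith+
  moreover have "f u \<noteq> f v" using st(3) by (auto simp: u_def v_def min_def max_def split: if_splits)
  ultimately have "f u < f v" by simp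
  moreover have "Suc (k - 1) = k" using k by simp
  ultimately show thesis using uv k by (intro that[of "k - 1" u v]) auto
qed

text \<open>The tail integral of \<open>sin (x * (1 - t))\<close> is
  \<open>(1 - cos (x * (1 - t))) / x\<close>, which is nonnegative. Unless \<open>x\<close> is a
  multiple of \<open>2 * pi\<close>, it is positive at 0.\<close>

lemma reflected_sine_transform_pos:
  assumes gen: "general_case f" and x: "0 < x"
  shows "0 < integral {0..1} (\<lambda>t. f t * sin (x * (1 - t)))"
proof -
  define T where "T t = (1 - cos (x * (1 - t))) / x" for t
  have T: "(T has_real_derivative - sin (x * (1 - t))) (at t)" for t
    unfolding T_def using x by (auto intro!: derivative_eq_intros)
  have \<phi>: "continuous_on UNIV (\<lambda>t. sin (x * (1 - t)))" by (intro continuous_intros)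
  have T1: "T 1 = 0" by (simp add: T_def)
  have Tpos: "0 \<le> T t" for t using x by (simp add: T_def)
  show ?thesis
  proof (cases "cos x = 1")
    case False
    then have "cos x < 1" using cos_le_one[of x] by linarith
    then have "0 < T 0" using x by (simp add: T_def)
    then show ?thesis
      by (intro integral_mult_pos_of_initial_tail[OF T \<phi> T1 _ Tpos]) auto
  next
    case True
    \<comment> \<open>Now \<open>T\<close> vanishes in \<open>[0,1]\<close> exactly at the multiples
      of \<open>1 / m\<close>; an increase of \<open>f\<close> strictly inside one cell supplies the
      positivity.\<close>
    then obtain n :: int where n: "x = real_of_int n * 2 * pi" using cos_one_2pi_int by blast
    then have "0 < n" using x by (simp add: zero_less_mult_iff)
    define m where "m = nat n"
    have m: "0 < m" "x = real m * 2 * pi" using \<open>0 < n\<close> n by (auto simp: m_def)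
    obtain k u v where kuv: "k < m" "real k / real m < u" "u < v" "v < real (Suc k) / real m" "f u < f v"
      using general_case_increase[OF gen m(1)] by blast
    have bds: "0 \<le> real k / real m" "real (Suc k) / real m \<le> 1" using kuv(1) m by auto
    have "0 < T t" if t: "u \<le> t" "t \<le> v" for t
    proof -
      have "cos (x * (1 - t)) \<noteq> 1"
      proof
        assume "cos (x * (1 - t)) = 1"
        then obtain j :: int where "x * (1 - t) = real_of_int j * 2 * pi" using cos_one_2pi_int by blast
        then have "(real m * (1 - t)) * (2 * pi) = real_of_int j * (2 * pi)"
          unfolding m(2) by (simp add: mult_ac)
        then have "real m * (1 - t) = real_of_int j" by simp
        then have mt: "real m * t = real_of_int (int m - j)" by (simp add: algebra_simps)
        have "real k / real m < t" "t < real (Suc k) / real m" using t kuv by auto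
        then have "real k < real m * t" "real m * t < real (Suc k)" using m by (auto simp: field_simps)
        then have "int k < int m - j" "int m - j < int k + 1" unfolding mt by linarith+
        then show False by linarith
      qed
      then have "cos (x * (1 - t)) < 1" using cos_le_one[of "x * (1 - t)"] by linarith
      then show ?thesis using x by (simp add: T_def)
    qed
    moreover have "0 < u" "v < 1" using kuv bds by linarith+
    ultimately show ?thesis
      using kuv by (intro integral_mult_pos_of_increase[OF T \<phi> T1 _ Tpos, of u v]) auto
  qed
qed

lemma sine_cosine_transform_pos:
  assumes "general_case f" "0 < x"
  shows "0 < cosine_transform f x * sin x - integral {0..1} (\<lambda>t. f t * sin (x * t)) * cos x"
proof -
  have "((\<lambda>t. f t * cos (x * t) * sin x - f t * sin (x * t) * cos x) has_integral
      cosine_transform f x * sin x - integral {0..1} (\<lambda>t. f t * sin (x * t)) * cos x) {0..1}"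
    unfolding cosine_transform_eq
    by (intro has_integral_diff has_integral_mult_left integrable_integral
        integrable_mult continuous_intros) auto
  moreover have "(\<lambda>t. f t * cos (x * t) * sin x - f t * sin (x * t) * cos x) =
      (\<lambda>t. f t * sin (x * (1 - t)))"
    by (simp add: fun_eq_iff right_diff_distrib sin_diff algebra_simps)
  ultimately show ?thesis using reflected_sine_transform_pos[OF assms] integral_unique by metis
qed

text \<open>At a zero, \<open>sine_cosine_transform_pos\<close> makes \<open>?V\<close> nonzero with
  sign opposite to \<open>cos x\<close>; the energy bound gives \<open>?W\<close> the sign of
  \<open>?V\<close>, and the derivative is \<open>- ?W\<close>.\<close>

lemma cosine_transform_deriv_at_zero:
  assumes gen: "general_case f" and x: "0 < x" and zero: "cosine_transform f x = 0"
  obtains D where "(cosine_transform f has_real_derivative D) (at x)" "0 < D * cos x"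
proof
  let ?V = "integral {0..1} (\<lambda>t. f t * sin (x * t))"
  let ?W = "integral {0..1} (\<lambda>t. f t * (t * sin (x * t)))"
  show "(cosine_transform f has_real_derivative - ?W) (at x)"
    by (rule cosine_transform_has_derivative)
  have V: "?V * cos x < 0" using sine_cosine_transform_pos[OF gen x] zero by simp
  then have "?V \<noteq> 0" by auto
  then have "0 < ?V\<^sup>2" by simp
  then have "0 < ?W * ?V" using cosine_transform_zero_energy[OF zero] by linarith
  then show "0 < - ?W * cos x"
    using V by (auto simp: zero_less_mult_iff mult_less_0_iff)
qed

lemma continuous_on_cosine_transform: "continuous_on S (cosine_transform f)"
  using cosine_transform_has_derivative
  by (intro continuous_at_imp_continuous_on) (auto intro: DERIV_isCont)

text \<open>On this interval \<open>(- 1) ^ k * cos x\<close> is positive, so the transform times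
  \<open>(- 1) ^ k\<close> crosses each of its zeros upwards.\<close>

lemma cosine_transform_zero_unique:
  assumes gen: "general_case f" and k: "1 \<le> k"
    and a: "(real k - 1 / 2) * pi < a" "a < (real k + 1 / 2) * pi" "cosine_transform f a = 0"
    and b: "(real k - 1 / 2) * pi < b" "b < (real k + 1 / 2) * pi" "cosine_transform f b = 0"
  shows "a = b"
proof -
  have no_two: False
    if ab: "a < b" and a: "(real k - 1 / 2) * pi < a" "cosine_transform f a = 0"
      and b: "b < (real k + 1 / 2) * pi" "cosine_transform f b = 0" for a b
  proof (rule real_zeros_unique_of_deriv_pos[of a b "\<lambda>x. (- 1) ^ k * cosine_transform f x"])
    show "continuous_on {a..b} (\<lambda>x. (- 1) ^ k * cosine_transform f x)"
      by (intro continuous_intros continuous_on_cosine_transform)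
    fix x assume x: "a \<le> x" "x \<le> b" "(- 1) ^ k * cosine_transform f x = 0"
    have "0 < (real k - 1 / 2) * pi" using k by simp
    then have "0 < x" using a x by linarith
    then obtain D where D: "(cosine_transform f has_real_derivative D) (at x)" "0 < D * cos x"
      using cosine_transform_deriv_at_zero[OF gen] x(3) by auto
    have "0 < (- 1) ^ k * cos x" using a b x by (intro cos_alternating_pos) auto
    with D(2) have "0 < (- 1) ^ k * D"
      by (auto simp: zero_less_mult_iff mult_less_0_iff)
    moreover have "((\<lambda>x. (- 1) ^ k * cosine_transform f x) has_real_derivative (- 1) ^ k * D) (at x)"
      by (rule DERIV_cmult[OF D(1)])
    ultimately show "\<exists>D>0. ((\<lambda>x. (- 1) ^ k * cosine_transform f x) has_real_derivative D) (at x)"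
      by blast
  qed (use ab a b in auto)
  show ?thesis using no_two[of a b] no_two[of b a] a b by (meson linorder_neqE)
qed

text \<open>Where the cosine vanishes, \<open>sine_cosine_transform_pos\<close> reduces to the
  transform times \<open>sin x = (- 1) ^ k\<close>.\<close>

lemma cosine_transform_sign_half_odd_pi:
  assumes "general_case f"
  shows "0 < (- 1) ^ k * cosine_transform f ((real k + 1 / 2) * pi)"
proof -
  have "0 < (real k + 1 / 2) * pi" by (intro mult_pos_pos) auto
  from sine_cosine_transform_pos[OF assms this] show ?thesis
    unfolding cos_half_odd_pi sin_half_odd_pi by (simp only: mult_zero_right diff_zero mult.commute)
qed

text \<open>The tail integral of \<open>cos (x * t)\<close> is
  \<open>(sin x - sin (x * t)) / x\<close>, nonnegative because sine increases up to
  \<open>pi / 2\<close>.\<close>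

lemma cosine_transform_pos_upto_half_pi:
  assumes x: "0 < x" "x \<le> pi / 2"
  shows "0 < cosine_transform f x"
  unfolding cosine_transform_eq
proof (rule integral_mult_pos_of_initial_tail)
  let ?T = "\<lambda>t. (sin x - sin (x * t)) / x"
  show "(?T has_real_derivative - cos (x * t)) (at t)" for t
    using x by (auto intro!: derivative_eq_intros)
  show "0 \<le> ?T t" if "0 \<le> t" "t \<le> 1" for t
  proof -
    have "x * t \<le> x" "0 \<le> x * t" using that x by (auto simp: mult_left_le)
    then have "sin (x * t) \<le> sin x" using x pi_gt_zero by (intro sin_monotone_2pi_le) linarith+
    then show ?thesis using x by simp
  qed
  show "0 < ?T 0" using x sin_gt_zero[of x] by simp
qed (auto intro!: continuous_intros)

text \<open>The tail integral of \<open>- cos (pi * t)\<close> is \<open>sin (pi * t) / pi\<close>.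
  It vanishes at 0 but is positive inside, so any increase of \<open>f\<close> suffices.\<close>

lemma cosine_transform_pi_neg:
  assumes "general_case f"
  shows "cosine_transform f pi < 0"
proof -
  obtain k u v where "k < 1" "real k / real 1 < u" "u < v" "v < real (Suc k) / real 1" "f u < f v"
    by (rule general_case_increase[OF assms zero_less_one])
  then have uv: "0 < u" "u < v" "v < 1" "f u < f v" by auto
  have "0 < integral {0..1} (\<lambda>t. f t * - cos (pi * t))"
  proof (rule integral_mult_pos_of_increase[of "\<lambda>t. sin (pi * t) / pi"])
    show "((\<lambda>t. sin (pi * t) / pi) has_real_derivative - (- cos (pi * t))) (at t)" for t
      by (auto intro!: derivative_eq_intros)
    show "0 \<le> sin (pi * t) / pi" if "0 \<le> t" "t \<le> 1" for t
      using that by (intro divide_nonneg_pos sin_ge_zero) auto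
    show "0 < sin (pi * t) / pi" if "u \<le> t" "t \<le> v" for t
      using that uv by (intro divide_pos_pos sin_gt_zero) auto
  qed (use uv in \<open>auto intro!: continuous_intros\<close>)
  then show ?thesis by (simp add: cosine_transform_eq)
qed

lemma cosine_transform_zero_gt_half_pi:
  assumes gen: "general_case f" and x: "0 < x" "cosine_transform f x = 0"
  obtains k where "1 \<le> k" "(real k - 1 / 2) * pi < x" "x < (real k + 1 / 2) * pi"
proof -
  have gt: "pi / 2 < x" using cosine_transform_pos_upto_half_pi[of x] x by force
  define k where "k = nat \<lfloor>x / pi + 1 / 2\<rfloor>"
  have "1 \<le> x / pi + 1 / 2" using gt by (simp add: field_simps)
  then have k: "1 \<le> k" "real k \<le> x / pi + 1 / 2" "x / pi + 1 / 2 < real k + 1"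
    unfolding k_def by linarith+
  \<comment> \<open>The floor leaves equality possible at the left end; there the cosine would
    vanish, which a zero of the transform forbids.\<close>
  have "(real k - 1 / 2) * pi \<noteq> x"
  proof
    assume "(real k - 1 / 2) * pi = x"
    moreover have "real k - 1 / 2 = real (k - 1) + 1 / 2" using k by simp
    ultimately have "cos x = 0" using cos_half_odd_pi[of "k - 1"] by metis
    then show False using cosine_transform_deriv_at_zero[OF gen x] by auto
  qed
  then show thesis
    using k by (intro that[of k]) (auto simp: field_simps)
qed

text \<open>Stated for subintervals because \<open>(pi / 2, pi)\<close> is only half of the interval
  between two zeros of the cosine.\<close>

lemma exactly_one_zero_simple_cosine_transform:
  assumes gen: "general_case f" and k: "1 \<le> k"
    and ab: "(real k - 1 / 2) * pi \<le> a" "a \<le> b" "b \<le> (real k + 1 / 2) * pi"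
    and sign: "(- 1) ^ k * cosine_transform f a < 0" "0 < (- 1) ^ k * cosine_transform f b"
  shows "exactly_one_zero_simple (cosine_transform f) {a<..<b}"
proof -
  have a0: "0 < a" using k ab pi_gt_zero by (smt (verit) mult_pos_pos of_nat_1 of_nat_le_iff field_sum_of_halves)
  have "\<exists>z\<ge>a. z \<le> b \<and> (- 1) ^ k * cosine_transform f z = 0"
    using sign ab by (intro IVT') (auto intro!: continuous_intros continuous_on_cosine_transform)
  then obtain z where z: "a \<le> z" "z \<le> b" "cosine_transform f z = 0" by auto
  have "z \<noteq> a" "z \<noteq> b" using z sign by auto
  then have z': "z \<in> {a<..<b}" using z by auto
  have "w = z" if "w \<in> {a<..<b}" "cosine_transform f w = 0" for w
    using cosine_transform_zero_unique[OF gen k, of w z] that z z' ab by auto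
  moreover have "simple_zero (cosine_transform f) w"
    if w: "w \<in> {a<..<b}" "cosine_transform f w = 0" for w
  proof -
    have "0 < w" using w a0 by simp
    then obtain D where "(cosine_transform f has_real_derivative D) (at w)" "0 < D * cos w"
      using cosine_transform_deriv_at_zero[OF gen] w by blast
    then show ?thesis using w unfolding simple_zero_def by auto
  qed
  ultimately show ?thesis unfolding exactly_one_zero_simple_def using z z' by blast
qed

end

theorem corollary4p2:
  fixes f :: "real \<Rightarrow> real"
  assumes "\<forall>t\<in>{0<..<1}. f t > 0"
    and "mono_on {0<..<1} f"
    and "general_case f"
    and "f integrable_on {0<..<1}"
  shows "exactly_one_zero_simple (cosine_transform f) {pi / 2<..<pi}
    \<and> (\<forall>k::nat. k \<ge> 1 \<longrightarrow>
         exactly_one_zero_simple (cosine_transform f)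
           {(real k + 1 / 2) * pi<..<(real k + 3 / 2) * pi})
    \<and> (\<forall>x>0. cosine_transform f x = 0 \<longrightarrow>
         x \<in> {pi / 2<..<pi} \<or>
         (\<exists>k::nat. k \<ge> 1 \<and> x \<in> {(real k + 1 / 2) * pi<..<(real k + 3 / 2) * pi}))"
proof -
  interpret increasing_weight f
    using assms by unfold_locales (auto simp: monotone_on_def)
  note gen = assms(3)
  have first: "exactly_one_zero_simple (cosine_transform f) {pi / 2<..<pi}"
    using cosine_transform_pos_upto_half_pi[of "pi / 2"] cosine_transform_pi_neg[OF gen]
    by (intro exactly_one_zero_simple_cosine_transform[OF gen, of 1]) auto
  \<comment> \<open>Between these end points the cosine has the sign of
    \<open>(- 1) ^ Suc k\<close>, hence the shift of index.\<close>
  have later: "exactly_one_zero_simple (cosine_transform f)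
      {(real k + 1 / 2) * pi<..<(real k + 3 / 2) * pi}" for k :: nat
  proof (rule exactly_one_zero_simple_cosine_transform[OF gen, of "Suc k"])
    show "(- 1) ^ Suc k * cosine_transform f ((real k + 1 / 2) * pi) < 0"
      using cosine_transform_sign_half_odd_pi[OF gen, of k] by simp
    have "real (Suc k) + 1 / 2 = real k + 3 / 2" by simp
    then show "0 < (- 1) ^ Suc k * cosine_transform f ((real k + 3 / 2) * pi)"
      using cosine_transform_sign_half_odd_pi[OF gen, of "Suc k"] by metis
  qed auto
  have "x \<in> {pi / 2<..<pi} \<or> (\<exists>k::nat. k \<ge> 1 \<and> x \<in> {(real k + 1 / 2) * pi<..<(real k + 3 / 2) * pi})"
    if x: "0 < x" "cosine_transform f x = 0" for x
  proof -
    obtain k where k: "1 \<le> k" "(real k - 1 / 2) * pi < x" "x < (real k + 1 / 2) * pi"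
      using cosine_transform_zero_gt_half_pi[OF gen x] by blast
    show ?thesis
    \<comment> \<open>For \<open>k = 1\<close> uniqueness up to \<open>3 * pi / 2\<close> identifies
      \<open>x\<close> with the zero already found below \<open>pi\<close>; otherwise the index
      shifts down by one.\<close>
    proof (cases "k = 1")
      case True
      obtain z where "z \<in> {pi / 2<..<pi}" "cosine_transform f z = 0"
        using first unfolding exactly_one_zero_simple_def by blast
      moreover from this have "x = z"
        using cosine_transform_zero_unique[OF gen, of 1 x z] k True x by auto
      ultimately show ?thesis by blast
    next
      case False
      then have "1 \<le> k - 1" using k by auto
      moreover have "real k - 1 / 2 = real (k - 1) + 1 / 2" "real k + 1 / 2 = real (k - 1) + 3 / 2"
        using k by simp_all
      ultimately show ?thesis using k by (metis greaterThanLessThan_iff)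
    qed
  qed
  with first later show ?thesis by blast
qed

end
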